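(* Let $\alpha,\beta$ be positive constants, $J\subset\mathbb{R}$ an open interval, and $f,g:J\to\mathbb{R}$ smooth functions. (i) Suppose $\alpha^2 f^2(u)-\beta^2 g^2(u)>0$ and $f'^2(u)+g'^2(u)>0$ for all $u\in J$, and let $\mathcal{M}_1$ be the general rotational surface of first type determined by $f,g,\alpha,\beta$ in the Minkowski space $\mathbb{R}^4_1$. Assume $\mathcal{M}_1$ is not contained in a 2-plane. Then $\mathcal{M}_1$ is minimal if and only if the meridian curve is given by the formula $$g = \frac{\sqrt{A}}{\beta} \sin \left( \varepsilon \frac{\beta}{\alpha} \ln \left| \alpha f + \sqrt{\alpha^2 f^2 - A} \right| + C \right),$$ where $C$ is a constant, $A>0$ is a constant, and $\varepsilon=\pm1$. (ii) Suppose $f'^2(u)-g'^2(u)>0$ and $\alpha^2 f^2(u)+\beta^2 g^2(u)>0$ for all $u\in J$, and let $\mathcal{M}_2$ be the general rotational surface of second type determined by $f,g,\alpha,\beta$ in $\mathbb{R}^4_1$. Assume $\mathcal{M}_2$ is not contained in a 2-plane. Then $\mathcal{M}_2$ is minimal if and only if the meridian curve is given by the formula $$g = \frac{\sqrt{A}}{\beta} \sin \left( \varepsilon \frac{\beta}{\alpha} \ln \left| \alpha f + \sqrt{\alpha^2 f^2 + A} \right| + C \right),$$ where $C$ is a constant, $A>0$ is a constant, and $\varepsilon=\pm1$.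
   Context: $\mathbb{R}^4_1$ is $\mathbb{R}^4$ with the metric $\langle x,y\rangle=x_1y_1+x_2y_2+x_3y_3-x_4y_4$. A surface in $\mathbb{R}^4_1$ is spacelike if the induced metric is Riemannian. The general rotational surface of first type is the spacelike surface $$\mathcal{M}_1:\ z(u,v)=\left(f(u)\cos\alpha v,\ f(u)\sin\alpha v,\ g(u)\cosh\beta v,\ g(u)\sinh\beta v\right),\quad u\in J,\ v\in[0,2\pi),$$ where $\alpha^2 f^2-\beta^2 g^2>0$ and $f'^2+g'^2>0$. The general rotational surface of second type is the spacelike surface $$\mathcal{M}_2:\ z(u,v)=\left(f(u)\cos\alpha v,\ f(u)\sin\alpha v,\ g(u)\sinh\beta v,\ g(u)\cosh\beta v\right),\quad u\in J,\ v\in[0,2\pi),$$ where $f'^2-g'^2>0$ and $\alpha^2 f^2+\beta^2 g^2>0$. The parametric curves $v=\mathrm{const}$ are the meridians; the meridian curve is represented by the plane curve $u\mapsto(f(u),g(u))$, and the formulas in the claim are relations between $f=f(u)$ and $g=g(u)$. A spacelike surface is minimal if its mean curvature vector $H=\frac12\operatorname{tr}\sigma$ vanishes identically, where the second fundamental tensor $\sigma(x,y)$ is the normal component of $\nabla'_xy$ for tangent vector fields $x,y$, and $\nabla'$ is the Levi-Civita connection of $\mathbb{R}^4_1$.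
   Formalization: In (i), "given by the formula" is corrected to allow two branches with the same A but own C and ε, joined at a point where f'=0; with a single C and ε on all of J the claim fails, e.g. α=β=1, f=cosh u, g=sin u. If f' has no zero it is the formula as stated. *)

theory Defs
  imports "HOL-Analysis.Analysis"
begin

definition smooth_on :: "real set \<Rightarrow> (real \<Rightarrow> real) \<Rightarrow> bool" where
  "smooth_on J f \<longleftrightarrow> (\<forall>n. \<forall>u\<in>J. (deriv ^^ n) f differentiable (at u))"


subsection \<open>Spacelike surfaces in Minkowski space\<close>

text \<open>Points and tangent vectors of Minkowski space are elements of \<^typ>\<open>real ^ 4\<close>; the
  Euclidean inner product of that type plays no role below.\<close>

definition mink :: "real ^ 4 \<Rightarrow> real ^ 4 \<Rightarrow> real" where
  "mink x y = x $ 1 * y $ 1 + x $ 2 * y $ 2 + x $ 3 * y $ 3 - x $ 4 * y $ 4"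

text \<open>A surface is a parametrization \<open>z u v\<close>. It is a total function, so that both partial
  derivatives are two-sided also on the edge \<open>v = 0\<close> of the parameter domain
  \<open>J \<times> [0, 2\<pi>)\<close>.\<close>

definition du :: "(real \<Rightarrow> real \<Rightarrow> real ^ 4) \<Rightarrow> real \<Rightarrow> real \<Rightarrow> real ^ 4" where
  "du z u v = vector_derivative (\<lambda>s. z s v) (at u)"

definition dv :: "(real \<Rightarrow> real \<Rightarrow> real ^ 4) \<Rightarrow> real \<Rightarrow> real \<Rightarrow> real ^ 4" where
  "dv z u v = vector_derivative (\<lambda>t. z u t) (at v)"

definition spacelike_at :: "(real \<Rightarrow> real \<Rightarrow> real ^ 4) \<Rightarrow> real \<Rightarrow> real \<Rightarrow> bool" where
  "spacelike_at z u v \<longleftrightarrow>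
    (\<forall>a b. (a, b) \<noteq> (0, 0) \<longrightarrow>
      mink (a *\<^sub>R du z u v + b *\<^sub>R dv z u v) (a *\<^sub>R du z u v + b *\<^sub>R dv z u v) > 0)"

definition tangent_plane :: "(real \<Rightarrow> real \<Rightarrow> real ^ 4) \<Rightarrow> real \<Rightarrow> real \<Rightarrow> (real ^ 4) set" where
  "tangent_plane z u v = span {du z u v, dv z u v}"

text \<open>The normal component is uniquely determined wherever the surface is spacelike.\<close>

definition normal_component ::
    "(real \<Rightarrow> real \<Rightarrow> real ^ 4) \<Rightarrow> real \<Rightarrow> real \<Rightarrow> real ^ 4 \<Rightarrow> real ^ 4" where
  "normal_component z u v w =
    (THE n. w - n \<in> tangent_plane z u v \<and> (\<forall>t\<in>tangent_plane z u v. mink n t = 0))"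

text \<open>The Levi-Civita connection of Minkowski space is flat: in the standard coordinates
  \<open>\<nabla>'\<close> differentiates componentwise, so that \<open>\<nabla>'\<close> of the coordinate field \<open>z\<^sub>v\<close> along
  \<open>z\<^sub>u\<close> is the partial derivative \<open>z\<^sub>u\<^sub>v\<close>, and similarly for the other pairs. The values
  of the second fundamental tensor on the coordinate fields are therefore the following.\<close>

definition sigma_uu :: "(real \<Rightarrow> real \<Rightarrow> real ^ 4) \<Rightarrow> real \<Rightarrow> real \<Rightarrow> real ^ 4" where
  "sigma_uu z u v = normal_component z u v (du (du z) u v)"

definition sigma_uv :: "(real \<Rightarrow> real \<Rightarrow> real ^ 4) \<Rightarrow> real \<Rightarrow> real \<Rightarrow> real ^ 4" where
  "sigma_uv z u v = normal_component z u v (du (dv z) u v)"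

definition sigma_vv :: "(real \<Rightarrow> real \<Rightarrow> real ^ 4) \<Rightarrow> real \<Rightarrow> real \<Rightarrow> real ^ 4" where
  "sigma_vv z u v = normal_component z u v (dv (dv z) u v)"

text \<open>The trace is taken with respect to the induced metric; the coefficients are the entries
  of the inverse of the matrix with rows \<open>(E, F)\<close> and \<open>(F, G)\<close>.\<close>

definition mean_curvature_vector ::
    "(real \<Rightarrow> real \<Rightarrow> real ^ 4) \<Rightarrow> real \<Rightarrow> real \<Rightarrow> real ^ 4" where
  "mean_curvature_vector z u v =
    (let E = mink (du z u v) (du z u v);
         F = mink (du z u v) (dv z u v);
         G = mink (dv z u v) (dv z u v);
         D = E * G - F\<^sup>2
     in (1/2) *\<^sub>R ((G / D) *\<^sub>R sigma_uu z u v - (2 * F / D) *\<^sub>R sigma_uv z u v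
                  + (E / D) *\<^sub>R sigma_vv z u v))"

definition minimal_surface :: "real set \<Rightarrow> (real \<Rightarrow> real \<Rightarrow> real ^ 4) \<Rightarrow> bool" where
  "minimal_surface J z \<longleftrightarrow>
    (\<forall>u\<in>J. \<forall>v\<in>{0..<2*pi}. spacelike_at z u v \<and> mean_curvature_vector z u v = 0)"

definition contained_in_2plane :: "real set \<Rightarrow> (real \<Rightarrow> real \<Rightarrow> real ^ 4) \<Rightarrow> bool" where
  "contained_in_2plane J z \<longleftrightarrow>
    (\<exists>P. affine P \<and> aff_dim P = 2 \<and> (\<forall>u\<in>J. \<forall>v\<in>{0..<2*pi}. z u v \<in> P))"


subsection \<open>General rotational surfaces\<close>

definition rot_surface1 ::
    "real \<Rightarrow> real \<Rightarrow> (real \<Rightarrow> real) \<Rightarrow> (real \<Rightarrow> real) \<Rightarrow> real \<Rightarrow> real \<Rightarrow> real ^ 4" where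
  "rot_surface1 \<alpha> \<beta> f g u v =
    vector [f u * cos (\<alpha> * v), f u * sin (\<alpha> * v), g u * cosh (\<beta> * v), g u * sinh (\<beta> * v)]"

definition rot_surface2 ::
    "real \<Rightarrow> real \<Rightarrow> (real \<Rightarrow> real) \<Rightarrow> (real \<Rightarrow> real) \<Rightarrow> real \<Rightarrow> real \<Rightarrow> real ^ 4" where
  "rot_surface2 \<alpha> \<beta> f g u v =
    vector [f u * cos (\<alpha> * v), f u * sin (\<alpha> * v), g u * sinh (\<beta> * v), g u * cosh (\<beta> * v)]"

text \<open>The closed formulas for the meridian curve, along a set \<open>I\<close> of parameters and with
  constants \<open>A\<close>, \<open>C\<close> and \<open>\<epsilon> = \<plusminus>1\<close>. The conjunct \<open>\<alpha>\<^sup>2 f\<^sup>2 - A \<ge> 0\<close> makes the real square root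
  in the first formula meaningful (\<^const>\<open>sqrt\<close> is an odd total function); then the argument
  of the logarithm is nonzero, because \<open>A > 0\<close>.\<close>

definition meridian_formula1 ::
    "real \<Rightarrow> real \<Rightarrow> real \<Rightarrow> (real \<Rightarrow> real) \<Rightarrow> (real \<Rightarrow> real) \<Rightarrow> real set \<Rightarrow> bool" where
  "meridian_formula1 \<alpha> \<beta> A f g I \<longleftrightarrow>
    (\<exists>C. \<exists>\<epsilon>\<in>{-1, 1}. \<forall>u\<in>I.
       \<alpha>\<^sup>2 * (f u)\<^sup>2 - A \<ge> 0 \<and>
       g u = sqrt A / \<beta> *
         sin (\<epsilon> * (\<beta> / \<alpha>) * ln \<bar>\<alpha> * f u + sqrt (\<alpha>\<^sup>2 * (f u)\<^sup>2 - A)\<bar> + C))"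

definition meridian_formula2 ::
    "real \<Rightarrow> real \<Rightarrow> real \<Rightarrow> (real \<Rightarrow> real) \<Rightarrow> (real \<Rightarrow> real) \<Rightarrow> real set \<Rightarrow> bool" where
  "meridian_formula2 \<alpha> \<beta> A f g I \<longleftrightarrow>
    (\<exists>C. \<exists>\<epsilon>\<in>{-1, 1}. \<forall>u\<in>I.
       g u = sqrt A / \<beta> *
         sin (\<epsilon> * (\<beta> / \<alpha>) * ln \<bar>\<alpha> * f u + sqrt (\<alpha>\<^sup>2 * (f u)\<^sup>2 + A)\<bar> + C))"

text \<open>In the first case the hypotheses allow turning points \<open>f'(u0) = 0\<close>, around which the curve
  is not a graph over \<open>f\<close>. For \<open>\<alpha> f = sqrt A cosh (\<alpha> u)\<close> and \<open>\<beta> g = sqrt A sin (\<beta> u)\<close>, which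
  gives a minimal surface, the sign \<open>\<epsilon>\<close> has to change at \<open>u = 0\<close>, and for \<open>A \<noteq> 1\<close> in general also
  \<open>C\<close>. Since the meridian of a minimal surface has at most one turning point, it is given by the
  formula if it is a single branch, or two branches with the same \<open>A\<close> that join at a turning
  point. If \<open>f'\<close> has no zero in \<open>J\<close>, only the single branch remains.\<close>

definition meridian_given_by_formula1 ::
    "real \<Rightarrow> real \<Rightarrow> (real \<Rightarrow> real) \<Rightarrow> (real \<Rightarrow> real) \<Rightarrow> real set \<Rightarrow> bool" where
  "meridian_given_by_formula1 \<alpha> \<beta> f g J \<longleftrightarrow>
    (\<exists>A>0. meridian_formula1 \<alpha> \<beta> A f g J \<or>
       (\<exists>u0\<in>J. deriv f u0 = 0 \<and>
          meridian_formula1 \<alpha> \<beta> A f g (J \<inter> {..u0}) \<and>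
          meridian_formula1 \<alpha> \<beta> A f g (J \<inter> {u0..})))"

text \<open>In the second case \<open>f'\<^sup>2 > g'\<^sup>2\<close> excludes turning points.\<close>

definition meridian_given_by_formula2 ::
    "real \<Rightarrow> real \<Rightarrow> (real \<Rightarrow> real) \<Rightarrow> (real \<Rightarrow> real) \<Rightarrow> real set \<Rightarrow> bool" where
  "meridian_given_by_formula2 \<alpha> \<beta> f g J \<longleftrightarrow> (\<exists>A>0. meridian_formula2 \<alpha> \<beta> A f g J)"

end

theory Submission
  imports Defs
begin

text \<open>The coordinate vectors \<open>z\<^sub>u\<close> and \<open>z\<^sub>v\<close> are orthogonal, so the surface is minimal iff
  \<open>G z\<^sub>u\<^sub>u + E z\<^sub>v\<^sub>v\<close> is tangent. As \<open>z\<^sub>u\<^sub>u\<close>, \<open>z\<^sub>v\<^sub>v\<close> and \<open>z\<^sub>u\<close> lie in a common plane orthogonal to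
  \<open>z\<^sub>v\<close>, this is a single ordinary differential equation for \<open>(f, g)\<close>. With \<open>\<lambda> = \<surd>(G / E)\<close> it
  is equivalent to \<open>(\<lambda> f')' = \<alpha>\<^sup>2 f / \<lambda>\<close> and \<open>(\<lambda> g')' = - \<beta>\<^sup>2 g / \<lambda>\<close>. Consequently
  \<open>A = \<beta>\<^sup>2 g\<^sup>2 + \<lambda>\<^sup>2 g'\<^sup>2 = \<plusminus>(\<alpha>\<^sup>2 f\<^sup>2 - \<lambda>\<^sup>2 f'\<^sup>2)\<close> is constant, \<open>ln \<bar>\<alpha> f + \<eta> \<lambda> f'\<bar>\<close> has derivative
  \<open>\<eta> \<alpha> / \<lambda>\<close> for \<open>\<eta> = \<plusminus>1\<close>, and \<open>(\<beta> g, \<lambda> g')\<close> rotates with angular velocity \<open>\<beta> / \<lambda>\<close>; comparing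
  these two rates gives the formula, \<open>\<eta>\<close> being the sign of \<open>f'\<close>. Conversely, the equation follows
  by differentiating the formula twice wherever its square root is positive. In the first case
  the root can vanish, but not on an open set, and continuity settles the remaining points.\<close>

subsection \<open>Mean curvature of general rotational surfaces\<close>

text \<open>Second derivatives are continuous because third derivatives exist. The continuity is
  what later carries the differential equation across isolated bad points.\<close>

lemma smooth_on_derivs:
  assumes "smooth_on J f" and "u \<in> J"
  shows "(f has_real_derivative deriv f u) (at u)"
    and "(deriv f has_real_derivative deriv (deriv f) u) (at u)"
    and "isCont (deriv (deriv f)) u"
proof -
  have d: "(deriv ^^ n) f differentiable (at u)" for n
    using assms unfolding smooth_on_def by blast
  show "(f has_real_derivative deriv f u) (at u)"
    using d[of 0] by (simp add: DERIV_deriv_iff_real_differentiable)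
  show "(deriv f has_real_derivative deriv (deriv f) u) (at u)"
    using d[of 1] by (simp add: DERIV_deriv_iff_real_differentiable)
  show "isCont (deriv (deriv f)) u"
    using differentiable_imp_continuous_within[OF d[of 2]] by (simp add: numeral_2_eq_2)
qed

lemma has_real_derivative_ln_abs:
  assumes "(h has_real_derivative d) (at u)" and "h u \<noteq> 0"
  shows "((\<lambda>w. ln \<bar>h w\<bar>) has_real_derivative d / h u) (at u)"
proof -
  have "((\<lambda>w. ln ((h w)\<^sup>2) / 2) has_real_derivative (1 / (h u)\<^sup>2 * (2 * h u * d)) / 2) (at u)"
    using assms by (auto intro!: derivative_eq_intros)
  \<comment> \<open>Squaring avoids a case distinction on the sign of \<open>h\<close>. The identity
    is stated for all \<open>w\<close>, so zeros of \<open>h\<close> enter through the default value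
    \<open>ln 0 = 0\<close>.\<close>
  moreover have "ln ((h w)\<^sup>2) / 2 = ln \<bar>h w\<bar>" for w
    using ln_realpow[of "\<bar>h w\<bar>" 2] by (cases "h w = 0") simp_all
  ultimately show ?thesis using assms(2) by (simp add: power2_eq_square)
qed

section \<open>The Minkowski product and normal components\<close>

lemma mink_add_left: "mink (x + y) w = mink x w + mink y w"
  and mink_add_right: "mink w (x + y) = mink w x + mink w y"
  and mink_diff_left: "mink (x - y) w = mink x w - mink y w"
  and mink_diff_right: "mink w (x - y) = mink w x - mink w y"
  and mink_scaleR_left: "mink (c *\<^sub>R x) w = c * mink x w"
  and mink_scaleR_right: "mink w (c *\<^sub>R x) = c * mink w x"
  by (simp_all add: mink_def algebra_simps)

lemmas mink_bilinear = mink_add_left mink_add_right mink_diff_left mink_diff_right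
  mink_scaleR_left mink_scaleR_right

lemma mink_commute: "mink x y = mink y x"
  by (simp add: mink_def mult.commute)

lemma span_pair_iff:
  "x \<in> span {p, q} \<longleftrightarrow> (\<exists>h k. x = h *\<^sub>R p + k *\<^sub>R q)"
  by (auto simp: span_insert span_singleton diff_eq_eq add.commute)

text \<open>Orthogonal projection along an orthogonal basis of the tangent plane. Uniqueness comes
  from pairing with the two basis vectors: this kills \<open>n\<close> and determines both
  tangential coefficients, since \<open>E\<close> and \<open>G\<close> are positive.\<close>

lemma normal_component_orthogonal_frame:
  assumes E: "mink (du z u v) (du z u v) > 0" and F: "mink (du z u v) (dv z u v) = 0"
    and G: "mink (dv z u v) (dv z u v) > 0"
  shows "normal_component z u v w =
    w - (mink w (du z u v) / mink (du z u v) (du z u v)) *\<^sub>R du z u v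
      - (mink w (dv z u v) / mink (dv z u v) (dv z u v)) *\<^sub>R dv z u v"
    (is "_ = ?n")
proof -
  let ?p = "du z u v" and ?q = "dv z u v"
  have F': "mink ?q ?p = 0" using F by (simp add: mink_commute)
  show ?thesis
    unfolding normal_component_def
  proof (rule the_equality)
    have "w - ?n \<in> tangent_plane z u v"
      unfolding tangent_plane_def span_pair_iff by (intro exI) simp
    moreover have "mink ?n t = 0" if t: "t \<in> tangent_plane z u v" for t
    proof -
      obtain h k where "t = h *\<^sub>R ?p + k *\<^sub>R ?q"
        using t unfolding tangent_plane_def span_pair_iff by blast
      then show ?thesis using E F F' G by (simp add: mink_bilinear)
    qed
    ultimately show "w - ?n \<in> tangent_plane z u v \<and> (\<forall>t\<in>tangent_plane z u v. mink ?n t = 0)"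
      by simp
  next
    fix n assume n: "w - n \<in> tangent_plane z u v \<and> (\<forall>t\<in>tangent_plane z u v. mink n t = 0)"
    then obtain h k where hk: "w - n = h *\<^sub>R ?p + k *\<^sub>R ?q"
      unfolding tangent_plane_def span_pair_iff by blast
    have w: "w = n + h *\<^sub>R ?p + k *\<^sub>R ?q" using hk by (simp add: algebra_simps)
    have "?p \<in> tangent_plane z u v" "?q \<in> tangent_plane z u v"
      unfolding tangent_plane_def by (auto intro: span_base)
    then have "mink n ?p = 0" "mink n ?q = 0" using n by blast+
    then have "mink w ?p = h * mink ?p ?p" "mink w ?q = k * mink ?q ?q"
      unfolding w using F F' by (simp_all add: mink_bilinear)
    then have "h = mink w ?p / mink ?p ?p" "k = mink w ?q / mink ?q ?q"
      using E G by simp_all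
    moreover have "n = w - h *\<^sub>R ?p - k *\<^sub>R ?q" using w by simp
    ultimately show "n = ?n" by simp
  qed
qed

text \<open>Both types are treated together: \<open>s = 1\<close> for the first type and \<open>s = - 1\<close> for the second.\<close>

definition meridian_ode ::
    "real \<Rightarrow> real \<Rightarrow> real \<Rightarrow> (real \<Rightarrow> real) \<Rightarrow> (real \<Rightarrow> real) \<Rightarrow> real \<Rightarrow> real" where
  "meridian_ode s \<alpha> \<beta> f g u =
    (\<alpha>\<^sup>2 * (f u)\<^sup>2 - s * (\<beta>\<^sup>2 * (g u)\<^sup>2)) *
      (deriv f u * deriv (deriv g) u - deriv (deriv f) u * deriv g u)
    + ((deriv f u)\<^sup>2 + s * (deriv g u)\<^sup>2) *
      (\<beta>\<^sup>2 * (deriv f u * g u) + \<alpha>\<^sup>2 * (f u * deriv g u))"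

text \<open>The surface is \<open>f u *\<^sub>R a v + g u *\<^sub>R b v\<close>, where
  \<open>a\<close> turns in a Euclidean plane and \<open>b\<close> in the orthogonal Lorentzian
  plane. The fields \<open>a'\<close> and \<open>b'\<close> are the directions of motion, and
  \<open>s\<close> records whether \<open>b\<close> is spacelike or timelike.\<close>

locale rotational_frame =
  fixes s \<alpha> \<beta> :: real and a a' b b' :: "real \<Rightarrow> real ^ 4"
  assumes sign: "s * s = 1"
    and frame_deriv:
      "\<And>v. (a has_vector_derivative \<alpha> *\<^sub>R a' v) (at v)"
      "\<And>v. (a' has_vector_derivative - \<alpha> *\<^sub>R a v) (at v)"
      "\<And>v. (b has_vector_derivative \<beta> *\<^sub>R b' v) (at v)"
      "\<And>v. (b' has_vector_derivative \<beta> *\<^sub>R b v) (at v)"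
    and frame_mink:
      "\<And>v. mink (a v) (a v) = 1" "\<And>v. mink (a' v) (a' v) = 1"
      "\<And>v. mink (b v) (b v) = s" "\<And>v. mink (b' v) (b' v) = - s"
      "\<And>v. mink (a v) (a' v) = 0" "\<And>v. mink (a v) (b v) = 0" "\<And>v. mink (a v) (b' v) = 0"
      "\<And>v. mink (a' v) (b v) = 0" "\<And>v. mink (a' v) (b' v) = 0" "\<And>v. mink (b v) (b' v) = 0"
begin

lemma frame_mink_commuted:
  "mink (a' v) (a v) = 0" "mink (b v) (a v) = 0" "mink (b' v) (a v) = 0"
  "mink (b v) (a' v) = 0" "mink (b' v) (a' v) = 0" "mink (b' v) (b v) = 0"
  by (subst mink_commute, rule frame_mink)+

lemmas frame_products = frame_mink frame_mink_commuted

text \<open>Here \<open>z\<^sub>u\<close> lies in the plane of \<open>a\<close> and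
  \<open>b\<close>, and \<open>z\<^sub>v\<close> in that of \<open>a'\<close> and \<open>b'\<close>,
  so they are orthogonal. As \<open>z\<^sub>u\<^sub>u\<close> and \<open>z\<^sub>v\<^sub>v\<close>
  lie in the first plane, the mean curvature vector is a multiple of the single normal vector
  \<open>N\<close> in it.\<close>

lemma minimal_surface_iff_ode:
  assumes z: "z = (\<lambda>u v. f u *\<^sub>R a v + g u *\<^sub>R b v)"
    and J: "open J" and sm: "smooth_on J f" "smooth_on J g"
    and Gpos: "\<And>u. u \<in> J \<Longrightarrow> \<alpha>\<^sup>2 * (f u)\<^sup>2 - s * (\<beta>\<^sup>2 * (g u)\<^sup>2) > 0"
    and Epos: "\<And>u. u \<in> J \<Longrightarrow> (deriv f u)\<^sup>2 + s * (deriv g u)\<^sup>2 > 0"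
  shows "minimal_surface J z \<longleftrightarrow> (\<forall>u\<in>J. meridian_ode s \<alpha> \<beta> f g u = 0)"
proof -
  have sp: "spacelike_at z u v" 
    and H: "mean_curvature_vector z u v = 0 \<longleftrightarrow> meridian_ode s \<alpha> \<beta> f g u = 0"
    if u: "u \<in> J" for u v
  proof -
    define E where "E = (deriv f u)\<^sup>2 + s * (deriv g u)\<^sup>2"
    define G where "G = \<alpha>\<^sup>2 * (f u)\<^sup>2 - s * (\<beta>\<^sup>2 * (g u)\<^sup>2)"
    have E0: "E > 0" and G0: "G > 0" using Epos[OF u] Gpos[OF u] by (simp_all add: E_def G_def)
    note df = smooth_on_derivs(1)[OF sm(1)] and ddf = smooth_on_derivs(2)[OF sm(1)]
    note dg = smooth_on_derivs(1)[OF sm(2)] and ddg = smooth_on_derivs(2)[OF sm(2)]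
    have zu: "du z w v = deriv f w *\<^sub>R a v + deriv g w *\<^sub>R b v" if "w \<in> J" for w
      unfolding du_def z using df[OF that] dg[OF that]
      by (intro vector_derivative_at) (auto intro!: derivative_eq_intros)
    have zv: "dv z w t = (\<alpha> * f w) *\<^sub>R a' t + (\<beta> * g w) *\<^sub>R b' t" for w t
      unfolding dv_def z
      by (intro vector_derivative_at) (auto intro!: derivative_eq_intros frame_deriv simp: mult.commute)
    have "((\<lambda>w. deriv f w *\<^sub>R a v + deriv g w *\<^sub>R b v) has_vector_derivative
        deriv (deriv f) u *\<^sub>R a v + deriv (deriv g) u *\<^sub>R b v) (at u)"
      using ddf[OF u] ddg[OF u] by (auto intro!: derivative_eq_intros)
    \<comment> \<open>The formula for \<open>du z\<close> is known on \<open>J\<close> only;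
      openness of \<open>J\<close> lets it be differentiated at \<open>u\<close>.\<close>
    then have "((\<lambda>w. du z w v) has_vector_derivative
        deriv (deriv f) u *\<^sub>R a v + deriv (deriv g) u *\<^sub>R b v) (at u)"
      by (rule has_vector_derivative_transform_within_open[OF _ J u]) (simp add: zu)
    then have zuu: "du (du z) u v = deriv (deriv f) u *\<^sub>R a v + deriv (deriv g) u *\<^sub>R b v"
      unfolding du_def[of "du z"] by (rule vector_derivative_at)
    have zvv: "dv (dv z) u v = (- \<alpha>\<^sup>2 * f u) *\<^sub>R a v + (\<beta>\<^sup>2 * g u) *\<^sub>R b v"
      unfolding dv_def[of "dv z"] zv
      by (intro vector_derivative_at)
        (auto intro!: derivative_eq_intros frame_deriv simp: power2_eq_square mult_ac)
    have EE: "mink (du z u v) (du z u v) = E" and FF: "mink (du z u v) (dv z u v) = 0"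
      and GG: "mink (dv z u v) (dv z u v) = G"
      by (simp_all add: zu[OF u] zv mink_bilinear frame_products E_def G_def power2_eq_square)
    show "spacelike_at z u v"
      unfolding spacelike_at_def
    proof (intro allI impI)
      fix x y :: real assume xy: "(x, y) \<noteq> (0, 0)"
      have "mink (x *\<^sub>R du z u v + y *\<^sub>R dv z u v) (x *\<^sub>R du z u v + y *\<^sub>R dv z u v)
          = E * x\<^sup>2 + G * y\<^sup>2"
        using FF by (simp add: mink_bilinear EE GG mink_commute[of "dv z u v" "du z u v"] power2_eq_square)
      also have "\<dots> > 0"
        using xy E0 G0 by (cases "x = 0") (auto intro: add_pos_nonneg)
      finally show "mink (x *\<^sub>R du z u v + y *\<^sub>R dv z u v) (x *\<^sub>R du z u v + y *\<^sub>R dv z u v) > 0" .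
    qed
    \<comment> \<open>\<open>N\<close> spans the orthogonal complement of \<open>z\<^sub>u\<close>
      within the plane of \<open>a\<close> and \<open>b\<close>. It is not null, as
      \<open>mink N N = s * E\<close>.\<close>
    define N where "N = deriv f u *\<^sub>R b v - (s * deriv g u) *\<^sub>R a v"
    have normal: "normal_component z u v (h *\<^sub>R a v + k *\<^sub>R b v) =
        ((deriv f u * k - deriv g u * h) / E) *\<^sub>R N" for h k
    proof -
      let ?w = "h *\<^sub>R a v + k *\<^sub>R b v" and ?m = "h * deriv f u + s * (k * deriv g u)"
      have "normal_component z u v ?w = ?w - (?m / E) *\<^sub>R du z u v"
        using E0 G0 EE FF GG
        by (subst normal_component_orthogonal_frame)
          (simp_all add: zu[OF u] zv mink_bilinear frame_products)
      also have "\<dots> = (h - ?m / E * deriv f u) *\<^sub>R a v + (k - ?m / E * deriv g u) *\<^sub>R b v"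
        by (simp add: zu[OF u] algebra_simps)
      also have "h - ?m / E * deriv f u = - ((deriv f u * k - deriv g u * h) / E) * (s * deriv g u)"
      proof -
        have "h * E - ?m * deriv f u = - (deriv f u * k - deriv g u * h) * (s * deriv g u)"
          by (simp add: E_def algebra_simps power2_eq_square)
        moreover have "h - ?m / E * deriv f u = (h * E - ?m * deriv f u) / E"
          using E0 by (simp add: diff_divide_distrib)
        ultimately show ?thesis
          by (simp only: times_divide_eq_left minus_divide_left mult_minus_left)
      qed
      also have "k - ?m / E * deriv g u = (deriv f u * k - deriv g u * h) / E * deriv f u"
      proof -
        have "k * E - ?m * deriv g u = (deriv f u * k - deriv g u * h) * deriv f u"
          by (simp add: E_def algebra_simps power2_eq_square)
        moreover have "k - ?m / E * deriv g u = (k * E - ?m * deriv g u) / E"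
          using E0 by (simp add: diff_divide_distrib)
        ultimately show ?thesis by simp
      qed
      finally show ?thesis by (simp add: N_def algebra_simps)
    qed
    have N0: "N \<noteq> 0"
    proof
      assume "N = 0"
      then have "mink N N = 0" by (simp add: mink_def)
      moreover have "mink N N = s * E"
        by (simp add: N_def E_def mink_bilinear frame_products power2_eq_square algebra_simps)
      ultimately show False using sign E0 by auto
    qed
    have "mean_curvature_vector z u v
        = (1/2) *\<^sub>R ((G / (E * G)) *\<^sub>R sigma_uu z u v + (E / (E * G)) *\<^sub>R sigma_vv z u v)"
      by (simp add: mean_curvature_vector_def EE FF GG)
    \<comment> \<open>The terms for \<open>z\<^sub>u\<^sub>u\<close> and
      \<open>z\<^sub>v\<^sub>v\<close> carry the trace weights 1 / E and 1 / G, and each projection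
      contributes a further 1 / E. Over the common denominator the numerator is exactly
      \<open>meridian_ode\<close>.\<close>
    also have "\<dots> = (meridian_ode s \<alpha> \<beta> f g u / (2 * E\<^sup>2 * G)) *\<^sub>R N"
    proof -
      have coeff: "1/2 * (G / (E * G) * (X / E) + E / (E * G) * (Y / E))
          = (G * X + E * Y) / (2 * E\<^sup>2 * G)" for X Y
        using E0 G0 by (simp add: add_divide_distrib power2_eq_square mult_ac)
      have collect: "(1/2) *\<^sub>R (x *\<^sub>R (y *\<^sub>R N) + x' *\<^sub>R (y' *\<^sub>R N)) = (1/2 * (x * y + x' * y')) *\<^sub>R N"
        for x y x' y'
        by (simp add: algebra_simps)
      show ?thesis
        unfolding sigma_uu_def sigma_vv_def zuu zvv normal collect coeff
        unfolding meridian_ode_def E_def[symmetric] G_def[symmetric] by (simp add: mult_ac)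
    qed
    finally show "mean_curvature_vector z u v = 0 \<longleftrightarrow> meridian_ode s \<alpha> \<beta> f g u = 0"
      using N0 E0 G0 by simp
  qed
  \<comment> \<open>The equation does not involve \<open>v\<close>, so one admissible value of
    \<open>v\<close> recovers it from minimality.\<close>
  have "(0::real) \<in> {0..<2*pi}" by simp
  then show ?thesis unfolding minimal_surface_def using sp H by blast
qed

end

section \<open>Concrete frames of the two types and planar surfaces\<close>

lemma vector_4 [simp]:
  "(vector [x, y, z, w] :: ('a::zero) ^ 4) $ 1 = x"
  "(vector [x, y, z, w] :: ('a::zero) ^ 4) $ 2 = y"
  "(vector [x, y, z, w] :: ('a::zero) ^ 4) $ 3 = z"
  "(vector [x, y, z, w] :: ('a::zero) ^ 4) $ 4 = w"
  unfolding vector_def by simp_all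

lemma scaleR_vector_4:
  "c *\<^sub>R (vector [x, y, z, w] :: real ^ 4) = vector [c * x, c * y, c * z, c * w]"
  by (simp add: vec_eq_iff forall_4)

lemma has_vector_derivative_vec4:
  fixes p q r s :: "real \<Rightarrow> real"
  assumes "(p has_real_derivative p') (at u)" "(q has_real_derivative q') (at u)"
    "(r has_real_derivative r') (at u)" "(s has_real_derivative s') (at u)"
  shows "((\<lambda>t. vector [p t, q t, r t, s t] :: real ^ 4) has_vector_derivative
    vector [p', q', r', s']) (at u)"
proof -
  have vec4: "(vector [x, y, z, w] :: real ^ 4) =
      x *\<^sub>R axis 1 1 + y *\<^sub>R axis 2 1 + z *\<^sub>R axis 3 1 + w *\<^sub>R axis 4 1" for x y z w :: real
    by (simp add: vec_eq_iff forall_4 axis_def)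
  show ?thesis
    unfolding vec4 using assms by (auto intro!: derivative_eq_intros)
qed

lemma rotational_frame_type1:
  "rotational_frame 1 \<alpha> \<beta>
    (\<lambda>v. vector [cos (\<alpha> * v), sin (\<alpha> * v), 0, 0]) (\<lambda>v. vector [- sin (\<alpha> * v), cos (\<alpha> * v), 0, 0])
    (\<lambda>v. vector [0, 0, cosh (\<beta> * v), sinh (\<beta> * v)]) (\<lambda>v. vector [0, 0, sinh (\<beta> * v), cosh (\<beta> * v)])"
  unfolding rotational_frame_def scaleR_vector_4
  by (auto intro!: has_vector_derivative_vec4 derivative_eq_intros)
    (simp_all add: mink_def power2_eq_square[symmetric] cosh_square_eq)

text \<open>Exchanging \<open>cosh\<close> and \<open>sinh\<close> makes \<open>b\<close> timelike
  and \<open>b'\<close> spacelike, hence the sign -1.\<close>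

lemma rotational_frame_type2:
  "rotational_frame (- 1) \<alpha> \<beta>
    (\<lambda>v. vector [cos (\<alpha> * v), sin (\<alpha> * v), 0, 0]) (\<lambda>v. vector [- sin (\<alpha> * v), cos (\<alpha> * v), 0, 0])
    (\<lambda>v. vector [0, 0, sinh (\<beta> * v), cosh (\<beta> * v)]) (\<lambda>v. vector [0, 0, cosh (\<beta> * v), sinh (\<beta> * v)])"
  unfolding rotational_frame_def scaleR_vector_4
  by (auto intro!: has_vector_derivative_vec4 derivative_eq_intros)
    (simp_all add: mink_def power2_eq_square[symmetric] cosh_square_eq)

lemma rot_surface1_eq:
  "rot_surface1 \<alpha> \<beta> f g = (\<lambda>u v. f u *\<^sub>R vector [cos (\<alpha> * v), sin (\<alpha> * v), 0, 0]
    + g u *\<^sub>R vector [0, 0, cosh (\<beta> * v), sinh (\<beta> * v)])"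
  by (simp add: rot_surface1_def fun_eq_iff vec_eq_iff forall_4)

lemma rot_surface2_eq:
  "rot_surface2 \<alpha> \<beta> f g = (\<lambda>u v. f u *\<^sub>R vector [cos (\<alpha> * v), sin (\<alpha> * v), 0, 0]
    + g u *\<^sub>R vector [0, 0, sinh (\<beta> * v), cosh (\<beta> * v)])"
  by (simp add: rot_surface2_def fun_eq_iff vec_eq_iff forall_4)

text \<open>If \<open>g\<close> vanished on all of \<open>J\<close>, the surface would lie in this
  coordinate plane. A surface outside every 2-plane therefore has a point with
  \<open>g u \<noteq> 0\<close>, which makes the constant \<open>A\<close> positive.\<close>

lemma contained_in_2plane_if_coordinates_vanish:
  assumes "\<And>u v. u \<in> J \<Longrightarrow> z u v $ 3 = 0 \<and> z u v $ 4 = 0"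
  shows "contained_in_2plane J z"
proof -
  let ?B = "{axis 1 1, axis 2 1} :: (real ^ 4) set"
  have "independent ?B"
    by (rule independent_mono[OF independent_Basis]) (auto simp: Basis_vec_def)
  moreover have "card ?B = 2" by (simp add: axis_eq_axis)
  ultimately have "aff_dim (span ?B) = 2"
    by (simp add: aff_dim_subspace dim_span dim_eq_card_independent)
  moreover have "z u v \<in> span ?B" if "u \<in> J" for u v
  proof -
    have "z u v = z u v $ 1 *\<^sub>R axis 1 1 + z u v $ 2 *\<^sub>R axis 2 1"
      using assms[OF that] by (simp add: vec_eq_iff forall_4 axis_def)
    then show ?thesis unfolding span_pair_iff by blast
  qed
  ultimately show ?thesis
    unfolding contained_in_2plane_def by (meson subspace_imp_affine subspace_span)
qed

subsection \<open>The meridian of a minimal surface\<close>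

lemma constant_on_interval:
  fixes h :: "real \<Rightarrow> real"
  assumes J: "is_interval J" "J \<noteq> {}"
    and h: "\<And>u. u \<in> J \<Longrightarrow> (h has_real_derivative 0) (at u)"
  obtains c where "\<And>u. u \<in> J \<Longrightarrow> h u = c"
proof -
  have "convex J" using J by (simp add: is_interval_convex_1)
  then have "\<exists>c. \<forall>u\<in>J. h u = c"
    by (rule has_field_derivative_zero_constant) (use h in \<open>auto intro: has_field_derivative_at_within\<close>)
  then show ?thesis using that by blast
qed

text \<open>In the parameter \<open>\<tau>\<close> with \<open>d\<tau> = du / \<lambda>\<close> the parametrization is isothermal and the equation
  of minimal surfaces decouples into \<open>f\<^sub>\<tau>\<^sub>\<tau> = \<alpha>\<^sup>2 f\<close> and \<open>g\<^sub>\<tau>\<^sub>\<tau> = - \<beta>\<^sup>2 g\<close>.\<close>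

lemma meridian_ode_decoupled:
  assumes J: "open J" and sm: "smooth_on J f" "smooth_on J g"
    and s: "s * s = 1"
    and Gpos: "\<And>u. u \<in> J \<Longrightarrow> \<alpha>\<^sup>2 * (f u)\<^sup>2 - s * (\<beta>\<^sup>2 * (g u)\<^sup>2) > 0"
    and Epos: "\<And>u. u \<in> J \<Longrightarrow> (deriv f u)\<^sup>2 + s * (deriv g u)\<^sup>2 > 0"
    and ode: "\<And>u. u \<in> J \<Longrightarrow> meridian_ode s \<alpha> \<beta> f g u = 0"
  obtains lam where
    "\<And>u. u \<in> J \<Longrightarrow> lam u > 0"
    "\<And>u. u \<in> J \<Longrightarrow> (lam u)\<^sup>2 * ((deriv f u)\<^sup>2 + s * (deriv g u)\<^sup>2) = \<alpha>\<^sup>2 * (f u)\<^sup>2 - s * (\<beta>\<^sup>2 * (g u)\<^sup>2)"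
    "\<And>u. u \<in> J \<Longrightarrow> ((\<lambda>w. lam w * deriv f w) has_real_derivative \<alpha>\<^sup>2 * f u / lam u) (at u)"
    "\<And>u. u \<in> J \<Longrightarrow> ((\<lambda>w. lam w * deriv g w) has_real_derivative - (\<beta>\<^sup>2 * g u / lam u)) (at u)"
proof -
  define E where "E w = (deriv f w)\<^sup>2 + s * (deriv g w)\<^sup>2" for w
  define G where "G w = \<alpha>\<^sup>2 * (f w)\<^sup>2 - s * (\<beta>\<^sup>2 * (g w)\<^sup>2)" for w
  define lam where "lam w = sqrt (G w / E w)" for w
  have E0: "E u > 0" and G0: "G u > 0" if "u \<in> J" for u
    using Epos[OF that] Gpos[OF that] by (simp_all add: E_def G_def)
  have lam0: "lam u > 0" if "u \<in> J" for u using E0[OF that] G0[OF that] by (simp add: lam_def)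
  have lamE: "(lam u)\<^sup>2 * E u = G u" if "u \<in> J" for u
    using E0[OF that] G0[OF that] by (simp add: lam_def)
  have both: "((\<lambda>w. lam w * deriv f w) has_real_derivative \<alpha>\<^sup>2 * f u / lam u) (at u) \<and>
    ((\<lambda>w. lam w * deriv g w) has_real_derivative - (\<beta>\<^sup>2 * g u / lam u)) (at u)" if u: "u \<in> J" for u
  proof -
    define f1 f2 g1 g2 l where "f1 = deriv f u" and "f2 = deriv (deriv f) u"
      and "g1 = deriv g u" and "g2 = deriv (deriv g) u" and "l = lam u"
    note defs = f1_def f2_def g1_def g2_def l_def
    have df: "(f has_real_derivative f1) (at u)" and ddf: "(deriv f has_real_derivative f2) (at u)"
      and dg: "(g has_real_derivative g1) (at u)" and ddg: "(deriv g has_real_derivative g2) (at u)"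
      unfolding defs using smooth_on_derivs[OF sm(1) u] smooth_on_derivs[OF sm(2) u] by blast+
    have "\<exists>D. (E has_real_derivative D) (at u)"
      unfolding E_def by (rule exI) (auto intro!: derivative_eq_intros ddf ddg)
    then obtain DE where DE: "(E has_real_derivative DE) (at u)" by blast
    have "\<exists>D. (G has_real_derivative D) (at u)"
      unfolding G_def by (rule exI) (auto intro!: derivative_eq_intros df dg)
    then obtain DG where DG: "(G has_real_derivative DG) (at u)" by blast
    have "((\<lambda>w. G w / E w) has_real_derivative (DG * E u - G u * DE) / (E u * E u)) (at u)"
      using DERIV_divide[OF DG DE] E0[OF u] by simp
    from DERIV_chain2[OF DERIV_real_sqrt this] have "\<exists>D. (lam has_real_derivative D) (at u)"
      unfolding lam_def using E0[OF u] G0[OF u] by auto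
    then obtain l' where dl: "(lam has_real_derivative l') (at u)" by blast
    define U where "U = l' * f1 + l * f2"
    define V where "V = l' * g1 + l * g2"
    have dU: "((\<lambda>w. lam w * deriv f w) has_real_derivative U) (at u)"
      unfolding U_def defs using ddf dl by (auto intro!: derivative_eq_intros simp: defs)
    have dV: "((\<lambda>w. lam w * deriv g w) has_real_derivative V) (at u)"
      unfolding V_def defs using ddg dl by (auto intro!: derivative_eq_intros simp: defs)
    \<comment> \<open>Both sides of \<open>(lam w)\<^sup>2 * E w = G w\<close> are differentiated,
      and the results are compared in fact \<open>1\<close>. This is the first of two linear
      relations between \<open>U\<close> and \<open>V\<close>; the second is the differential
      equation divided by \<open>E\<close>.\<close>
    have "((\<lambda>w. (lam w * deriv f w)\<^sup>2 + s * (lam w * deriv g w)\<^sup>2) has_real_derivative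
        2 * (l * f1) * U + s * (2 * (l * g1) * V)) (at u)"
      using DERIV_add[OF DERIV_power[OF dU, of 2] DERIV_cmult[OF DERIV_power[OF dV, of 2], of s]]
      by (simp add: defs mult_ac)
    moreover have "(G has_real_derivative 2 * \<alpha>\<^sup>2 * f u * f1 - s * (2 * \<beta>\<^sup>2 * g u * g1)) (at u)"
      unfolding G_def using df dg by (auto intro!: derivative_eq_intros)
    then have "((\<lambda>w. (lam w * deriv f w)\<^sup>2 + s * (lam w * deriv g w)\<^sup>2) has_real_derivative
        2 * \<alpha>\<^sup>2 * f u * f1 - s * (2 * \<beta>\<^sup>2 * g u * g1)) (at u)"
      by (rule has_field_derivative_transform_within_open[OF _ J u])
        (simp add: lamE[symmetric] E_def power_mult_distrib algebra_simps)
    ultimately have 1: "2 * (l * f1) * U + s * (2 * (l * g1) * V)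
        = 2 * \<alpha>\<^sup>2 * f u * f1 - s * (2 * \<beta>\<^sup>2 * g u * g1)"
      by (rule DERIV_unique)
    have 2: "l\<^sup>2 * (f1 * g2 - f2 * g1) + (\<beta>\<^sup>2 * (f1 * g u) + \<alpha>\<^sup>2 * (f u * g1)) = 0"
    proof -
      have "G u * (f1 * g2 - f2 * g1) + E u * (\<beta>\<^sup>2 * (f1 * g u) + \<alpha>\<^sup>2 * (f u * g1)) = 0"
        using ode[OF u] by (simp add: meridian_ode_def E_def G_def defs)
      then have "E u * (l\<^sup>2 * (f1 * g2 - f2 * g1) + (\<beta>\<^sup>2 * (f1 * g u) + \<alpha>\<^sup>2 * (f u * g1))) = 0"
        by (simp add: lamE[OF u, symmetric] l_def algebra_simps)
      then show ?thesis using E0[OF u] by simp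
    qed
    \<comment> \<open>\<open>X\<close> and \<open>Y\<close> measure the failure of the two decoupled
      equations. They satisfy a homogeneous linear system with determinant \<open>E u\<close>, which
      is positive, so both vanish.\<close>
    define X where "X = l * U - \<alpha>\<^sup>2 * f u"
    define Y where "Y = l * V + \<beta>\<^sup>2 * g u"
    have 3: "f1 * X + s * g1 * Y = 0" using 1 by (simp add: X_def Y_def algebra_simps)
    \<comment> \<open>The unknown derivative \<open>l'\<close> cancels in this combination.\<close>
    have 4: "f1 * Y - g1 * X = 0"
      using 2 by (simp add: X_def Y_def U_def V_def algebra_simps power2_eq_square)
    have Eu: "E u = f1 * f1 + s * g1 * g1" by (simp add: E_def defs power2_eq_square)
    have "E u * X = f1 * (f1 * X + s * g1 * Y) - s * g1 * (f1 * Y - g1 * X)"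
      unfolding Eu by (simp add: algebra_simps)
    then have "X = 0" using 3 4 E0[OF u] by simp
    moreover have "E u * Y = g1 * (f1 * X + s * g1 * Y) + f1 * (f1 * Y - g1 * X)"
      unfolding Eu by (simp add: algebra_simps)
    then have "Y = 0" using 3 4 E0[OF u] by simp
    ultimately have "U = \<alpha>\<^sup>2 * f u / lam u" "V = - (\<beta>\<^sup>2 * g u / lam u)"
      using lam0[OF u] by (simp_all add: X_def Y_def l_def field_simps)
    then show ?thesis using dU dV by simp
  qed
  show ?thesis using that[of lam] lam0 lamE both unfolding E_def G_def by blast
qed

text \<open>The rotating pair \<open>(\<beta> * g, lam * deriv g)\<close> has constant squared
  length \<open>A\<close>, and \<open>lamE\<close> turns this into the relation for
  \<open>f\<close>. The formula is proved on all of \<open>J\<close> for both signs \<eta>, with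
  \<open>C\<close> depending on \<eta>: which sign turns \<open>lam * deriv f\<close> into the
  square root is decided later and may differ on the two sides of a turning point.\<close>

lemma meridian_first_integral:
  assumes J: "open J" "is_interval J" "J \<noteq> {}" and pos: "\<alpha> > 0" "\<beta> > 0"
    and sm: "smooth_on J f" "smooth_on J g"
    and s: "s * s = 1"
    and lam0: "\<And>u. u \<in> J \<Longrightarrow> lam u > 0"
    and lamE: "\<And>u. u \<in> J \<Longrightarrow>
      (lam u)\<^sup>2 * ((deriv f u)\<^sup>2 + s * (deriv g u)\<^sup>2) = \<alpha>\<^sup>2 * (f u)\<^sup>2 - s * (\<beta>\<^sup>2 * (g u)\<^sup>2)"
    and dF: "\<And>u. u \<in> J \<Longrightarrow> ((\<lambda>w. lam w * deriv f w) has_real_derivative \<alpha>\<^sup>2 * f u / lam u) (at u)"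
    and dG: "\<And>u. u \<in> J \<Longrightarrow> ((\<lambda>w. lam w * deriv g w) has_real_derivative - (\<beta>\<^sup>2 * g u / lam u)) (at u)"
    and nz: "\<exists>u\<in>J. g u \<noteq> 0"
  obtains A where "A > 0"
    "\<And>u. u \<in> J \<Longrightarrow> \<alpha>\<^sup>2 * (f u)\<^sup>2 - s * A = (lam u * deriv f u)\<^sup>2"
    "\<And>\<eta>. \<eta> \<in> {-1, 1} \<Longrightarrow> \<exists>C. \<forall>u\<in>J. g u = sqrt A / \<beta> *
      sin (\<eta> * (\<beta> / \<alpha>) * ln \<bar>\<alpha> * f u + \<eta> * (lam u * deriv f u)\<bar> + C)"
proof -
  note df = smooth_on_derivs(1)[OF sm(1)] and dg = smooth_on_derivs(1)[OF sm(2)]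
  define x where "x w = \<beta> * g w" for w
  define y where "y w = lam w * deriv g w" for w
  have dx: "(x has_real_derivative \<beta> / lam u * y u) (at u)" if "u \<in> J" for u
    unfolding x_def y_def using dg[OF that] lam0[OF that] by (auto intro!: derivative_eq_intros)
  have dy: "(y has_real_derivative - (\<beta> / lam u * x u)) (at u)" if "u \<in> J" for u
    unfolding y_def using dG[OF that] by (simp add: x_def power2_eq_square mult.assoc)
  have "((\<lambda>w. (x w)\<^sup>2 + (y w)\<^sup>2) has_real_derivative 0) (at u)" if "u \<in> J" for u
    using dx[OF that] dy[OF that] by (auto intro!: derivative_eq_intros)
  then obtain A where A: "\<And>u. u \<in> J \<Longrightarrow> (x u)\<^sup>2 + (y u)\<^sup>2 = A"
    using constant_on_interval[OF J(2,3)] by blast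
  have A0: "A > 0"
  proof -
    obtain u where "u \<in> J" "g u \<noteq> 0" using nz by blast
    then show ?thesis using A[of u] pos by (auto simp: x_def intro!: add_pos_nonneg)
  qed
  have FA: "\<alpha>\<^sup>2 * (f u)\<^sup>2 - s * A = (lam u * deriv f u)\<^sup>2" if "u \<in> J" for u
    using lamE[OF that] A[OF that, symmetric] by (simp add: x_def y_def power_mult_distrib algebra_simps)
  have "\<exists>C. \<forall>u\<in>J. g u = sqrt A / \<beta> *
      sin (\<eta> * (\<beta> / \<alpha>) * ln \<bar>\<alpha> * f u + \<eta> * (lam u * deriv f u)\<bar> + C)" if eta: "\<eta> \<in> {-1, 1}" for \<eta>
  proof -
    define m where "m w = \<alpha> * f w + \<eta> * (lam w * deriv f w)" for w
    define \<psi> where "\<psi> w = \<eta> * (\<beta> / \<alpha>) * ln \<bar>m w\<bar>" for w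
    have ee: "\<eta> * \<eta> = 1" using eta by auto
    \<comment> \<open>The product of \<open>m u\<close> with its conjugate
      \<open>\<alpha> * f u - \<eta> * (lam u * deriv f u)\<close> is \<open>s * A\<close>, which is
      nonzero.\<close>
    have m0: "m u \<noteq> 0" if "u \<in> J" for u
    proof
      assume "m u = 0"
      then have "(\<alpha> * f u)\<^sup>2 = (\<eta> * (lam u * deriv f u))\<^sup>2"
        by (simp add: m_def eq_neg_iff_add_eq_0[symmetric])
      also have "\<dots> = (lam u * deriv f u)\<^sup>2" using eta by auto
      finally have "s * A = 0" using FA[OF that] by (simp add: power_mult_distrib)
      then show False using A0 s by auto
    qed
    have dm: "(m has_real_derivative \<eta> * (\<alpha> / lam u) * m u) (at u)" if "u \<in> J" for u
    proof -
      have "(m has_real_derivative \<alpha> * deriv f u + \<eta> * (\<alpha>\<^sup>2 * f u / lam u)) (at u)"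
        unfolding m_def by (intro DERIV_add DERIV_cmult df dF that)
      also have "\<alpha> * deriv f u + \<eta> * (\<alpha>\<^sup>2 * f u / lam u)
          = (\<eta> * \<eta>) * \<alpha> * deriv f u + \<eta> * (\<alpha>\<^sup>2 * f u / lam u)" by (simp add: ee)
      also have "\<dots> = \<eta> * (\<alpha> / lam u) * m u"
        using lam0[OF that] by (simp add: m_def field_simps power2_eq_square)
      finally show ?thesis .
    qed
    have dpsi: "(\<psi> has_real_derivative \<beta> / lam u) (at u)" if "u \<in> J" for u
    proof -
      have "(\<psi> has_real_derivative \<eta> * (\<beta> / \<alpha>) * (\<eta> * (\<alpha> / lam u) * m u / m u)) (at u)"
        unfolding \<psi>_def by (rule DERIV_cmult, rule has_real_derivative_ln_abs[OF dm[OF that] m0[OF that]])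
      also have "\<eta> * (\<beta> / \<alpha>) * (\<eta> * (\<alpha> / lam u) * m u / m u) = (\<eta> * \<eta>) * (\<beta> / lam u)"
        using m0[OF that] pos by simp
      finally show ?thesis by (simp add: ee)
    qed
    \<comment> \<open>Since \<open>\<psi>\<close> grows at the rate at which \<open>(x, y)\<close>
      turns clockwise, rotating \<open>(x, y)\<close> counterclockwise by \<open>\<psi>\<close>
      freezes it at a constant point \<open>(X, Y)\<close>.\<close>
    have "((\<lambda>w. x w * cos (\<psi> w) - y w * sin (\<psi> w)) has_real_derivative 0) (at u)" if "u \<in> J" for u
      using dx[OF that] dy[OF that] dpsi[OF that] by (auto intro!: derivative_eq_intros simp: algebra_simps)
    then obtain X where X: "\<And>u. u \<in> J \<Longrightarrow> x u * cos (\<psi> u) - y u * sin (\<psi> u) = X"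
      using constant_on_interval[OF J(2,3)] by blast
    have "((\<lambda>w. x w * sin (\<psi> w) + y w * cos (\<psi> w)) has_real_derivative 0) (at u)" if "u \<in> J" for u
      using dx[OF that] dy[OF that] dpsi[OF that] by (auto intro!: derivative_eq_intros simp: algebra_simps)
    then obtain Y where Y: "\<And>u. u \<in> J \<Longrightarrow> x u * sin (\<psi> u) + y u * cos (\<psi> u) = Y"
      using constant_on_interval[OF J(2,3)] by blast
    obtain u0 where u0: "u0 \<in> J" using J by blast
    have "X\<^sup>2 + Y\<^sup>2 = ((x u0)\<^sup>2 + (y u0)\<^sup>2) * ((sin (\<psi> u0))\<^sup>2 + (cos (\<psi> u0))\<^sup>2)"
      unfolding X[OF u0, symmetric] Y[OF u0, symmetric] by (simp only: power2_eq_square) algebra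
    then have "X\<^sup>2 + Y\<^sup>2 = A" using A[OF u0] by simp
    then have "(Y / sqrt A)\<^sup>2 + (X / sqrt A)\<^sup>2 = 1"
      using A0 by (simp add: power_divide add_divide_distrib[symmetric] add.commute)
    \<comment> \<open>\<open>C\<close> is the polar angle of \<open>(Y, X)\<close>, chosen so that
      undoing the rotation gives \<open>sin (\<psi> u + C)\<close> by the addition theorem.\<close>
    then obtain C where C: "Y / sqrt A = cos C" "X / sqrt A = sin C"
      using sincos_total_2pi_le by metis
    have "g u = sqrt A / \<beta> * sin (\<psi> u + C)" if "u \<in> J" for u
    proof -
      have XY: "X = sqrt A * sin C" "Y = sqrt A * cos C" using C A0 by (simp_all add: field_simps)
      have "x u = X * cos (\<psi> u) + Y * sin (\<psi> u)"
      proof -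
        have "X * cos (\<psi> u) + Y * sin (\<psi> u) = x u * ((sin (\<psi> u))\<^sup>2 + (cos (\<psi> u))\<^sup>2)"
          unfolding X[OF that, symmetric] Y[OF that, symmetric] by (simp only: power2_eq_square) algebra
        then show ?thesis by simp
      qed
      also have "\<dots> = sqrt A * sin (\<psi> u + C)" unfolding XY by (simp add: sin_add algebra_simps)
      finally show ?thesis using pos by (simp add: x_def field_simps)
    qed
    then show ?thesis unfolding \<psi>_def m_def by blast
  qed
  then show ?thesis using that A0 FA by blast
qed

subsection \<open>Surfaces with meridians given by the formula\<close>

text \<open>Write \<open>R\<close> for the square root and \<open>\<theta>\<close> for the argument
  of the sine. One differentiation gives
  \<open>R * deriv g = \<epsilon> * sqrt A * cos \<theta> * deriv f\<close>. Squaring this relation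
  yields \<open>PE\<close>, differentiating it again yields \<open>snd\<close>; together they give
  the equation multiplied by \<open>f1\<^sup>2\<close>. Positivity under the root makes
  \<open>R\<close> differentiable.\<close>

lemma meridian_ode_of_formula:
  assumes T: "open T" "u \<in> T" "T \<subseteq> J" and pos: "\<alpha> > 0" "\<beta> > 0" "A > 0"
    and sm: "smooth_on J f" "smooth_on J g" and s: "s * s = 1" and eps: "\<epsilon> \<in> {-1, 1}"
    and Ppos: "\<And>w. w \<in> T \<Longrightarrow> \<alpha>\<^sup>2 * (f w)\<^sup>2 - s * A > 0"
    and Epos: "(deriv f u)\<^sup>2 + s * (deriv g u)\<^sup>2 > 0"
    and form: "\<And>w. w \<in> T \<Longrightarrow> g w = sqrt A / \<beta> *
      sin (\<epsilon> * (\<beta> / \<alpha>) * ln \<bar>\<alpha> * f w + sqrt (\<alpha>\<^sup>2 * (f w)\<^sup>2 - s * A)\<bar> + C)"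
  shows "meridian_ode s \<alpha> \<beta> f g u = 0"
proof -
  define R where "R w = sqrt (\<alpha>\<^sup>2 * (f w)\<^sup>2 - s * A)" for w
  define m where "m w = \<alpha> * f w + R w" for w
  define \<theta> where "\<theta> w = \<epsilon> * (\<beta> / \<alpha>) * ln \<bar>m w\<bar> + C" for w
  have ee: "\<epsilon> * \<epsilon> = 1" using eps by auto
  have R0: "R w > 0" and R2: "R w * R w = \<alpha>\<^sup>2 * (f w)\<^sup>2 - s * A" if "w \<in> T" for w
    using Ppos[OF that] by (simp_all add: R_def)
  have df: "(f has_real_derivative deriv f w) (at w)"
    and ddf: "(deriv f has_real_derivative deriv (deriv f) w) (at w)"
    and dg: "(g has_real_derivative deriv g w) (at w)"
    and ddg: "(deriv g has_real_derivative deriv (deriv g) w) (at w)" if "w \<in> T" for w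
    using smooth_on_derivs[OF sm(1)] smooth_on_derivs[OF sm(2)] that T(3) by blast+
  have dR: "(R has_real_derivative \<alpha>\<^sup>2 * f w * deriv f w / R w) (at w)" if "w \<in> T" for w
  proof -
    have "((\<lambda>w. \<alpha>\<^sup>2 * (f w)\<^sup>2 - s * A) has_real_derivative 2 * (\<alpha>\<^sup>2 * f w * deriv f w)) (at w)"
      using df[OF that] by (auto intro!: derivative_eq_intros)
    from DERIV_chain2[OF DERIV_real_sqrt[OF Ppos[OF that]] this] show ?thesis
      using R0[OF that] by (simp add: R_def[abs_def] field_simps)
  qed
  have m0: "m w \<noteq> 0" if "w \<in> T" for w
  proof
    assume "m w = 0"
    then have "R w = - (\<alpha> * f w)" by (simp add: m_def)
    then have "R w * R w = \<alpha>\<^sup>2 * (f w)\<^sup>2" by (simp add: power2_eq_square)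
    then show False using R2[OF that] pos s by auto
  qed
  have dm: "(m has_real_derivative \<alpha> * deriv f w / R w * m w) (at w)" if "w \<in> T" for w
  proof -
    have "(m has_real_derivative \<alpha> * deriv f w + \<alpha>\<^sup>2 * f w * deriv f w / R w) (at w)"
      unfolding m_def by (intro DERIV_add DERIV_cmult df dR that)
    also have "\<alpha> * deriv f w + \<alpha>\<^sup>2 * f w * deriv f w / R w = \<alpha> * deriv f w / R w * m w"
      using R0[OF that] by (simp add: m_def field_simps power2_eq_square)
    finally show ?thesis .
  qed
  have dtheta: "(\<theta> has_real_derivative \<epsilon> * \<beta> * deriv f w / R w) (at w)" if "w \<in> T" for w
  proof -
    have "(\<theta> has_real_derivative \<epsilon> * (\<beta> / \<alpha>) * (\<alpha> * deriv f w / R w * m w / m w) + 0) (at w)"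
      unfolding \<theta>_def
      by (intro DERIV_add DERIV_const DERIV_cmult has_real_derivative_ln_abs dm m0 that)
    then show ?thesis using m0[OF that] pos by (simp add: mult.assoc)
  qed
  have g: "g w = sqrt A / \<beta> * sin (\<theta> w)" if "w \<in> T" for w
    using form[OF that] by (simp add: \<theta>_def m_def R_def)
  have first: "R w * deriv g w = \<epsilon> * sqrt A * (cos (\<theta> w) * deriv f w)" if w: "w \<in> T" for w
  proof -
    have "((\<lambda>w. sqrt A / \<beta> * sin (\<theta> w)) has_real_derivative
        sqrt A / \<beta> * (cos (\<theta> w) * (\<epsilon> * \<beta> * deriv f w / R w))) (at w)"
      by (intro DERIV_cmult DERIV_chain2[OF DERIV_sin] dtheta w)
    then have "(g has_real_derivative sqrt A / \<beta> * (cos (\<theta> w) * (\<epsilon> * \<beta> * deriv f w / R w))) (at w)"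
      by (rule has_field_derivative_transform_within_open[OF _ T(1) w]) (simp add: g)
    from DERIV_unique[OF this dg[OF w]] show ?thesis
      using R0[OF w] pos by (simp add: field_simps)
  qed
  define f1 f2 g1 g2 where "f1 = deriv f u" and "f2 = deriv (deriv f) u"
    and "g1 = deriv g u" and "g2 = deriv (deriv g) u"
  note defs = f1_def f2_def g1_def g2_def
  note u = T(2)
  let ?c = "\<epsilon> * sqrt A * cos (\<theta> u)"
  have fst: "R u * g1 = ?c * f1" using first[OF u] by (simp add: defs mult_ac)
  have "((\<lambda>w. \<epsilon> * sqrt A * (cos (\<theta> w) * deriv f w)) has_real_derivative
      \<epsilon> * sqrt A * ((- sin (\<theta> u) * (\<epsilon> * \<beta> * f1 / R u)) * f1 + f2 * cos (\<theta> u))) (at u)"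
    unfolding defs by (intro DERIV_cmult DERIV_mult DERIV_chain2[OF DERIV_cos] dtheta ddf u)
  then have "((\<lambda>w. R w * deriv g w) has_real_derivative
      \<epsilon> * sqrt A * ((- sin (\<theta> u) * (\<epsilon> * \<beta> * f1 / R u)) * f1 + f2 * cos (\<theta> u))) (at u)"
    by (rule has_field_derivative_transform_within_open[OF _ T(1) u]) (simp add: first)
  moreover have "((\<lambda>w. R w * deriv g w) has_real_derivative
      (\<alpha>\<^sup>2 * f u * f1 / R u) * g1 + g2 * R u) (at u)"
    unfolding defs by (intro DERIV_mult dR ddg u)
  ultimately have "(\<alpha>\<^sup>2 * f u * f1 / R u) * g1 + g2 * R u
      = \<epsilon> * sqrt A * ((- sin (\<theta> u) * (\<epsilon> * \<beta> * f1 / R u)) * f1 + f2 * cos (\<theta> u))"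
    using DERIV_unique by blast
  also have "\<dots> = - (\<epsilon> * \<epsilon>) * (\<beta> * (sqrt A * sin (\<theta> u))) * f1\<^sup>2 / R u + ?c * f2"
    by (simp add: algebra_simps power2_eq_square)
  also have "sqrt A * sin (\<theta> u) = \<beta> * g u" using g[OF u] pos by simp
  finally have "(\<alpha>\<^sup>2 * f u * f1 / R u) * g1 + g2 * R u = - (\<beta>\<^sup>2 * g u * f1\<^sup>2) / R u + ?c * f2"
    by (simp add: ee power2_eq_square mult_ac)
  then have snd: "\<alpha>\<^sup>2 * f u * f1 * g1 + R u * R u * g2 = - (\<beta>\<^sup>2 * g u * f1\<^sup>2) + R u * ?c * f2"
    using R0[OF u] by (simp add: field_simps)
  have f1: "f1 \<noteq> 0"
  proof
    assume "f1 = 0"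
    then have "g1 = 0" using fst R0[OF u] by simp
    then show False using Epos \<open>f1 = 0\<close> by (simp add: defs)
  qed
  define P G E where "P = R u * R u" and "G = \<alpha>\<^sup>2 * (f u)\<^sup>2 - s * (\<beta>\<^sup>2 * (g u)\<^sup>2)"
    and "E = f1\<^sup>2 + s * g1\<^sup>2"
  \<comment> \<open>Equivalently, \<open>R\<close> equals \<open>sqrt (G / E)\<close> times the
    modulus of \<open>f1\<close>. This allows \<open>P\<close> and \<open>f1\<^sup>2\<close> to be
    traded for \<open>G\<close> and \<open>E\<close> in the final relation.\<close>
  have PE: "P * E = G * f1\<^sup>2"
  proof -
    have "(\<beta> * g u)\<^sup>2 = A * (sin (\<theta> u))\<^sup>2" using g[OF u] pos by (simp add: power_mult_distrib)
    then have bg: "\<beta>\<^sup>2 * (g u)\<^sup>2 = A - A * (cos (\<theta> u))\<^sup>2"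
      by (simp add: sin_squared_eq power_mult_distrib algebra_simps)
    have "P * g1\<^sup>2 = (R u * g1)\<^sup>2" by (simp add: P_def power2_eq_square)
    also have "\<dots> = (\<epsilon> * \<epsilon>) * A * (cos (\<theta> u))\<^sup>2 * f1\<^sup>2"
      unfolding fst using pos by (simp add: power_mult_distrib power2_eq_square)
    also have "\<dots> = A * (cos (\<theta> u))\<^sup>2 * f1\<^sup>2" by (simp add: ee)
    finally have Pg: "P * g1\<^sup>2 = A * (cos (\<theta> u))\<^sup>2 * f1\<^sup>2" .
    have "P * E = P * f1\<^sup>2 + s * (P * g1\<^sup>2)" by (simp add: E_def algebra_simps)
    also have "\<dots> = G * f1\<^sup>2"
      unfolding Pg G_def bg by (simp add: P_def R2[OF u] algebra_simps)
    finally show ?thesis .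
  qed
  \<comment> \<open>By \<open>snd\<close> the bracket on the right becomes
    \<open>R u * ?c * f2\<close>, and by \<open>fst\<close> the last term cancels it.\<close>
  have "P * (f1 * g2 - f2 * g1) + f1\<^sup>2 * (\<beta>\<^sup>2 * (f1 * g u) + \<alpha>\<^sup>2 * (f u * g1))
      = f1 * (\<alpha>\<^sup>2 * f u * f1 * g1 + R u * R u * g2 + \<beta>\<^sup>2 * g u * f1\<^sup>2) - R u * f2 * (R u * g1)"
    by (simp add: P_def algebra_simps power2_eq_square)
  also have "\<dots> = 0" unfolding snd fst by (simp add: algebra_simps)
  finally have "E * (P * (f1 * g2 - f2 * g1) + f1\<^sup>2 * (\<beta>\<^sup>2 * (f1 * g u) + \<alpha>\<^sup>2 * (f u * g1))) = 0"
    by simp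
  then have "(P * E) * (f1 * g2 - f2 * g1) + f1\<^sup>2 * (E * (\<beta>\<^sup>2 * (f1 * g u) + \<alpha>\<^sup>2 * (f u * g1))) = 0"
    by (simp add: algebra_simps)
  then have "f1\<^sup>2 * (G * (f1 * g2 - f2 * g1) + E * (\<beta>\<^sup>2 * (f1 * g u) + \<alpha>\<^sup>2 * (f u * g1))) = 0"
    unfolding PE by (simp add: algebra_simps)
  then show ?thesis using f1 by (simp add: meridian_ode_def G_def E_def defs)
qed

text \<open>If the root vanished throughout the open set \<open>T\<close>, then
  \<open>f\<^sup>2\<close> and hence the logarithm would be constant there, so both \<open>f\<close>
  and \<open>g\<close> would have derivative zero, against \<open>Epos\<close>. At a point with
  positive root the previous computation applies.\<close>

lemma meridian_formula1_imp_ode_somewhere: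
  assumes T: "open T" "T \<noteq> {}" "T \<subseteq> J" and pos: "\<alpha> > 0" "\<beta> > 0" "A > 0"
    and sm: "smooth_on J f" "smooth_on J g"
    and Epos: "\<And>u. u \<in> J \<Longrightarrow> (deriv f u)\<^sup>2 + (deriv g u)\<^sup>2 > 0"
    and form: "meridian_formula1 \<alpha> \<beta> A f g T"
  shows "\<exists>u\<in>T. meridian_ode 1 \<alpha> \<beta> f g u = 0"
proof -
  obtain C \<epsilon> where eps: "\<epsilon> \<in> {-1, 1}"
    and P: "\<And>u. u \<in> T \<Longrightarrow> \<alpha>\<^sup>2 * (f u)\<^sup>2 - A \<ge> 0"
    and g: "\<And>u. u \<in> T \<Longrightarrow> g u = sqrt A / \<beta> *
         sin (\<epsilon> * (\<beta> / \<alpha>) * ln \<bar>\<alpha> * f u + sqrt (\<alpha>\<^sup>2 * (f u)\<^sup>2 - A)\<bar> + C)"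
    using form unfolding meridian_formula1_def by blast
  note df = smooth_on_derivs(1)[OF sm(1)] and dg = smooth_on_derivs(1)[OF sm(2)]
  have "\<exists>u\<in>T. \<alpha>\<^sup>2 * (f u)\<^sup>2 - A > 0"
  proof (rule ccontr)
    assume "\<not> ?thesis"
    then have eq: "\<alpha>\<^sup>2 * (f u)\<^sup>2 = A" if "u \<in> T" for u using P[OF that] that by force
    obtain u where u: "u \<in> T" using T by blast
    then have uJ: "u \<in> J" using T by blast
    have "((\<lambda>w. \<alpha>\<^sup>2 * (f w)\<^sup>2) has_real_derivative 2 * \<alpha>\<^sup>2 * f u * deriv f u) (at u)"
      using df[OF uJ] by (auto intro!: derivative_eq_intros)
    moreover have "((\<lambda>w. \<alpha>\<^sup>2 * (f w)\<^sup>2) has_real_derivative 0) (at u)"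
      by (rule has_field_derivative_transform_within_open[OF DERIV_const[of A] T(1) u]) (simp add: eq)
    ultimately have "2 * \<alpha>\<^sup>2 * f u * deriv f u = 0" by (rule DERIV_unique)
    moreover have "f u \<noteq> 0" using eq[OF u] pos by auto
    ultimately have "deriv f u = 0" using pos by simp
    moreover have "g w = sqrt A / \<beta> * sin (\<epsilon> * (\<beta> / \<alpha>) * ln (sqrt A) + C)" if "w \<in> T" for w
    proof -
      have "\<bar>\<alpha> * f w\<bar> = sqrt A"
        unfolding eq[OF that, symmetric] by (simp add: real_sqrt_mult abs_mult)
      then show ?thesis using g[OF that] by (simp add: eq[OF that])
    qed
    then have "(g has_real_derivative 0) (at u)"
      by (intro has_field_derivative_transform_within_open[OF DERIV_const T(1) u]) simp
    then have "deriv g u = 0" by (rule DERIV_imp_deriv)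
    ultimately show False using Epos[OF uJ] by simp
  qed
  then obtain u where u: "u \<in> T" "\<alpha>\<^sup>2 * (f u)\<^sup>2 - A > 0" by blast
  \<comment> \<open>Positivity of the expression under the root persists on an open neighbourhood of
    \<open>u\<close>, where the formula can be differentiated twice.\<close>
  have "continuous_on T (\<lambda>w. \<alpha>\<^sup>2 * (f w)\<^sup>2 - A)"
    using df T(3) by (intro continuous_intros continuous_at_imp_continuous_on) (auto intro: DERIV_isCont)
  then have op: "open (T \<inter> (\<lambda>w. \<alpha>\<^sup>2 * (f w)\<^sup>2 - A) -` {0<..})"
    using T(1) by (intro continuous_open_preimage) auto
  have "meridian_ode 1 \<alpha> \<beta> f g u = 0"
    by (rule meridian_ode_of_formula[OF op _ _ pos sm _ eps, where C = C])
      (use u T(3) Epos[of u] g in auto)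
  then show ?thesis using u(1) by blast
qed

lemma isCont_meridian_ode:
  assumes "smooth_on J f" "smooth_on J g" "u \<in> J"
  shows "isCont (meridian_ode s \<alpha> \<beta> f g) u"
  unfolding meridian_ode_def
  using smooth_on_derivs[OF assms(1,3)] smooth_on_derivs[OF assms(2,3)]
  by (intro continuous_intros) (auto intro: DERIV_isCont)

lemma meridian_formula1_subset:
  "meridian_formula1 \<alpha> \<beta> A f g I \<Longrightarrow> I' \<subseteq> I \<Longrightarrow> meridian_formula1 \<alpha> \<beta> A f g I'"
  unfolding meridian_formula1_def by (meson subsetD)

text \<open>The points of \<open>J\<close> where the equation fails form an open set. Every nonempty
  open subset of it on which a single branch is valid would contain a solution point, a
  contradiction.\<close>

lemma meridian_given_by_formula1_imp_ode:
  assumes J: "open J" and pos: "\<alpha> > 0" "\<beta> > 0"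
    and sm: "smooth_on J f" "smooth_on J g"
    and Epos: "\<And>u. u \<in> J \<Longrightarrow> (deriv f u)\<^sup>2 + (deriv g u)\<^sup>2 > 0"
    and form: "meridian_given_by_formula1 \<alpha> \<beta> f g J" and u: "u \<in> J"
  shows "meridian_ode 1 \<alpha> \<beta> f g u = 0"
proof (rule ccontr)
  assume nz: "\<not> ?thesis"
  have "continuous_on J (meridian_ode 1 \<alpha> \<beta> f g)"
    using isCont_meridian_ode[OF sm] by (intro continuous_at_imp_continuous_on) auto
  then have "open (J \<inter> meridian_ode 1 \<alpha> \<beta> f g -` (- {0}))"
    using J by (intro continuous_open_preimage) auto
  moreover define T where "T = J \<inter> meridian_ode 1 \<alpha> \<beta> f g -` (- {0})"
  ultimately have T: "open T" "T \<subseteq> J" "u \<in> T" using u nz by auto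
  have no_zero: False if "open S" "S \<noteq> {}" "S \<subseteq> T" "A > 0" "meridian_formula1 \<alpha> \<beta> A f g S" for S A
    using meridian_formula1_imp_ode_somewhere[OF that(1,2) _ pos that(4) sm Epos that(5)]
      that(3) T(2) by (auto simp: T_def)
  obtain A where A: "A > 0" and cases: "meridian_formula1 \<alpha> \<beta> A f g J \<or>
       (\<exists>u0\<in>J. meridian_formula1 \<alpha> \<beta> A f g (J \<inter> {..u0}) \<and>
          meridian_formula1 \<alpha> \<beta> A f g (J \<inter> {u0..}))"
    using form unfolding meridian_given_by_formula1_def by blast
  from cases show False
  proof
    assume "meridian_formula1 \<alpha> \<beta> A f g J"
    then show False
      using no_zero[OF T(1) _ _ A] T meridian_formula1_subset by blast
  next
    assume "\<exists>u0\<in>J. meridian_formula1 \<alpha> \<beta> A f g (J \<inter> {..u0}) \<and>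
          meridian_formula1 \<alpha> \<beta> A f g (J \<inter> {u0..})"
    then obtain u0 where l: "meridian_formula1 \<alpha> \<beta> A f g (J \<inter> {..u0})"
      and r: "meridian_formula1 \<alpha> \<beta> A f g (J \<inter> {u0..})" by blast
    \<comment> \<open>A nonempty open set is not a single point, so \<open>T\<close> reaches
      strictly to one side of the junction \<open>u0\<close>, where only one branch is
      involved.\<close>
    have "T \<noteq> {u0}" using T(1) not_open_singleton[of u0] by blast
    then obtain w where w: "w \<in> T" "w \<noteq> u0" using T(3) by blast
    show False
    proof (cases "w < u0")
      case True
      have "meridian_formula1 \<alpha> \<beta> A f g (T \<inter> {..<u0})"
        using l by (rule meridian_formula1_subset) (use T in auto)
      moreover have "open (T \<inter> {..<u0})" using T(1) by auto
      moreover have "T \<inter> {..<u0} \<noteq> {}" using w True by auto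
      ultimately show False using no_zero[OF _ _ Int_lower1 A] by blast
    next
      case False
      have "meridian_formula1 \<alpha> \<beta> A f g (T \<inter> {u0<..})"
        using r by (rule meridian_formula1_subset) (use T in auto)
      moreover have "open (T \<inter> {u0<..})" using T(1) by auto
      moreover have "T \<inter> {u0<..} \<noteq> {}" using w False by auto
      ultimately show False using no_zero[OF _ _ Int_lower1 A] by blast
    qed
  qed
qed

section \<open>From the differential equation to the branches of the formula\<close>

lemma sign_constant_on_interval:
  fixes h :: "real \<Rightarrow> real"
  assumes "is_interval J" "continuous_on J h" "\<And>u. u \<in> J \<Longrightarrow> h u \<noteq> 0"
  obtains \<eta> :: real where "\<eta> \<in> {-1, 1}" "\<And>u. u \<in> J \<Longrightarrow> \<eta> * h u > 0"
proof -
  have conn: "is_interval (h ` J)"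
    using assms by (simp add: is_interval_connected_1 connected_continuous_image)
  have "(\<forall>u\<in>J. h u > 0) \<or> (\<forall>u\<in>J. h u < 0)"
  proof (rule ccontr)
    assume "\<not> ?thesis"
    then obtain u w where "u \<in> J" "w \<in> J" "h u \<le> 0" "0 \<le> h w" by (auto simp: not_less)
    then have "0 \<in> h ` J" using conn unfolding is_interval_1 by blast
    then show False using assms(3) by force
  qed
  then show ?thesis using that[of 1] that[of "-1"] by auto
qed

text \<open>Where \<open>\<eta> * F u\<close> is nonnegative it is the square root itself, so \<eta>
  serves as \<epsilon>. The weak inequality admits a zero of \<open>F\<close>, so a branch may
  include its turning point.\<close>

lemma meridian_formula1I:
  assumes eta: "\<eta> \<in> {-1, 1}"
    and F: "\<And>u. u \<in> I \<Longrightarrow> \<alpha>\<^sup>2 * (f u)\<^sup>2 - A = (F u)\<^sup>2"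
    and sgn: "\<And>u. u \<in> I \<Longrightarrow> \<eta> * F u \<ge> 0"
    and C: "\<exists>C. \<forall>u\<in>I. g u = sqrt A / \<beta> * sin (\<eta> * (\<beta> / \<alpha>) * ln \<bar>\<alpha> * f u + \<eta> * F u\<bar> + C)"
  shows "meridian_formula1 \<alpha> \<beta> A f g I"
proof -
  have "sqrt (\<alpha>\<^sup>2 * (f u)\<^sup>2 - A) = \<eta> * F u" if "u \<in> I" for u
    unfolding F[OF that] using sgn[OF that] eta by (intro real_sqrt_unique) auto
  then show ?thesis
    unfolding meridian_formula1_def using C eta F by (metis zero_le_power2)
qed

text \<open>If \<open>deriv f\<close> has no zero, its sign selects a single branch. Otherwise
  \<open>f\<close>, which cannot vanish by \<open>Gpos\<close>, has a constant sign \<eta>, and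
  \<open>lam * deriv f\<close> changes monotonically because its derivative has the sign of
  \<open>f\<close>. It thus has sign \<open>- \<eta>\<close> or zero before the turning point and
  \<eta> or zero after it, which gives two branches with the same \<open>A\<close>.\<close>

lemma meridian_ode_imp_formula1:
  assumes J: "open J" "is_interval J" "J \<noteq> {}" and pos: "\<alpha> > 0" "\<beta> > 0"
    and sm: "smooth_on J f" "smooth_on J g"
    and Gpos: "\<And>u. u \<in> J \<Longrightarrow> \<alpha>\<^sup>2 * (f u)\<^sup>2 - \<beta>\<^sup>2 * (g u)\<^sup>2 > 0"
    and Epos: "\<And>u. u \<in> J \<Longrightarrow> (deriv f u)\<^sup>2 + (deriv g u)\<^sup>2 > 0"
    and nz: "\<exists>u\<in>J. g u \<noteq> 0"
    and ode: "\<And>u. u \<in> J \<Longrightarrow> meridian_ode 1 \<alpha> \<beta> f g u = 0"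
  shows "meridian_given_by_formula1 \<alpha> \<beta> f g J"
proof -
  obtain lam where lam0: "\<And>u. u \<in> J \<Longrightarrow> lam u > 0"
    and lamE: "\<And>u. u \<in> J \<Longrightarrow> (lam u)\<^sup>2 * ((deriv f u)\<^sup>2 + 1 * (deriv g u)\<^sup>2)
      = \<alpha>\<^sup>2 * (f u)\<^sup>2 - 1 * (\<beta>\<^sup>2 * (g u)\<^sup>2)"
    and dF: "\<And>u. u \<in> J \<Longrightarrow> ((\<lambda>w. lam w * deriv f w) has_real_derivative \<alpha>\<^sup>2 * f u / lam u) (at u)"
    and dG: "\<And>u. u \<in> J \<Longrightarrow> ((\<lambda>w. lam w * deriv g w) has_real_derivative - (\<beta>\<^sup>2 * g u / lam u)) (at u)"
    by (rule meridian_ode_decoupled[OF J(1) sm, of 1 \<alpha> \<beta>]) (use Gpos Epos ode in auto)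
  obtain A where A: "A > 0"
    and FA: "\<And>u. u \<in> J \<Longrightarrow> \<alpha>\<^sup>2 * (f u)\<^sup>2 - 1 * A = (lam u * deriv f u)\<^sup>2"
    and C: "\<And>\<eta>. \<eta> \<in> {-1, 1} \<Longrightarrow> \<exists>C. \<forall>u\<in>J. g u = sqrt A / \<beta> *
      sin (\<eta> * (\<beta> / \<alpha>) * ln \<bar>\<alpha> * f u + \<eta> * (lam u * deriv f u)\<bar> + C)"
    by (rule meridian_first_integral[OF J pos sm _ lam0 lamE dF dG nz]) auto
  have branch: "meridian_formula1 \<alpha> \<beta> A f g I"
    if "\<eta> \<in> {-1, 1}" "I \<subseteq> J" "\<And>u. u \<in> I \<Longrightarrow> \<eta> * (lam u * deriv f u) \<ge> 0" for \<eta> I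
  proof (rule meridian_formula1I[where F = "\<lambda>u. lam u * deriv f u"])
    show "\<exists>C. \<forall>u\<in>I. g u = sqrt A / \<beta> *
      sin (\<eta> * (\<beta> / \<alpha>) * ln \<bar>\<alpha> * f u + \<eta> * (lam u * deriv f u)\<bar> + C)"
      using C[OF that(1)] that(2) by blast
  qed (use that FA in auto)
  have contF: "continuous_on J (\<lambda>w. lam w * deriv f w)"
    using dF by (intro continuous_at_imp_continuous_on) (auto intro: DERIV_isCont)
  show ?thesis
  proof (cases "\<exists>u0\<in>J. deriv f u0 = 0")
    case False
    then have "lam u * deriv f u \<noteq> 0" if "u \<in> J" for u using lam0[OF that] that by auto
    then obtain \<eta> :: real where "\<eta> \<in> {-1, 1}" "\<And>u. u \<in> J \<Longrightarrow> \<eta> * (lam u * deriv f u) > 0"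
      using sign_constant_on_interval[OF J(2) contF] by blast
    then show ?thesis
      unfolding meridian_given_by_formula1_def using A branch[of \<eta> J] by (auto simp: less_imp_le)
  next
    case True
    then obtain u0 where u0: "u0 \<in> J" "deriv f u0 = 0" by blast
    have "f u \<noteq> 0" if "u \<in> J" for u
      using Gpos[OF that] by (auto simp: mult_less_0_iff)
    moreover have "continuous_on J f"
      using smooth_on_derivs(1)[OF sm(1)] by (intro continuous_at_imp_continuous_on) (auto intro: DERIV_isCont)
    ultimately obtain \<eta> :: real where eta: "\<eta> \<in> {-1, 1}" "\<And>u. u \<in> J \<Longrightarrow> \<eta> * f u > 0"
      using sign_constant_on_interval[OF J(2)] by blast
    have mono: "\<eta> * (lam u * deriv f u) \<le> \<eta> * (lam w * deriv f w)" if "u \<in> J" "w \<in> J" "u \<le> w" for u w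
    proof (rule DERIV_nonneg_imp_nondecreasing[OF that(3), where f = "\<lambda>w. \<eta> * (lam w * deriv f w)"])
      fix x assume "u \<le> x" "x \<le> w"
      then have x: "x \<in> J" using that J(2) unfolding is_interval_1 by blast
      have "\<eta> * (\<alpha>\<^sup>2 * f x / lam x) = \<alpha>\<^sup>2 * (\<eta> * f x) / lam x" by simp
      also have "\<dots> \<ge> 0" using eta(2)[OF x] lam0[OF x] by (simp add: less_imp_le)
      finally show "\<exists>y. ((\<lambda>w. \<eta> * (lam w * deriv f w)) has_real_derivative y) (at x) \<and> 0 \<le> y"
        using DERIV_cmult[OF dF[OF x], of \<eta>] by blast
    qed
    have "meridian_formula1 \<alpha> \<beta> A f g (J \<inter> {..u0})"
      by (rule branch[of "- \<eta>"]) (use eta mono[OF _ u0(1)] u0 in auto)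
    moreover have "meridian_formula1 \<alpha> \<beta> A f g (J \<inter> {u0..})"
      by (rule branch[of \<eta>]) (use eta mono[OF u0(1)] u0 in auto)
    ultimately show ?thesis
      unfolding meridian_given_by_formula1_def using A u0 by blast
  qed
qed

section \<open>The equivalence for the second type\<close>

text \<open>Now the expression under the root is at least \<open>A > 0\<close>, so the formula may
  be differentiated everywhere on \<open>J\<close>. Conversely, \<open>Epos\<close> keeps
  \<open>deriv f\<close> away from zero, so one sign \<eta> works on the whole interval.\<close>

lemma meridian_given_by_formula2_iff_ode:
  assumes J: "open J" "is_interval J" "J \<noteq> {}" and pos: "\<alpha> > 0" "\<beta> > 0"
    and sm: "smooth_on J f" "smooth_on J g"
    and Gpos: "\<And>u. u \<in> J \<Longrightarrow> \<alpha>\<^sup>2 * (f u)\<^sup>2 + \<beta>\<^sup>2 * (g u)\<^sup>2 > 0"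
    and Epos: "\<And>u. u \<in> J \<Longrightarrow> (deriv f u)\<^sup>2 - (deriv g u)\<^sup>2 > 0"
    and nz: "\<exists>u\<in>J. g u \<noteq> 0"
  shows "meridian_given_by_formula2 \<alpha> \<beta> f g J \<longleftrightarrow> (\<forall>u\<in>J. meridian_ode (- 1) \<alpha> \<beta> f g u = 0)"
proof
  assume "meridian_given_by_formula2 \<alpha> \<beta> f g J"
  then obtain A C \<epsilon> where A: "A > 0" and eps: "\<epsilon> \<in> {-1, 1}"
    and g: "\<And>u. u \<in> J \<Longrightarrow> g u = sqrt A / \<beta> *
         sin (\<epsilon> * (\<beta> / \<alpha>) * ln \<bar>\<alpha> * f u + sqrt (\<alpha>\<^sup>2 * (f u)\<^sup>2 + A)\<bar> + C)"
    unfolding meridian_given_by_formula2_def meridian_formula2_def by blast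
  show "\<forall>u\<in>J. meridian_ode (- 1) \<alpha> \<beta> f g u = 0"
  proof
    fix u assume u: "u \<in> J"
    show "meridian_ode (- 1) \<alpha> \<beta> f g u = 0"
      by (rule meridian_ode_of_formula[OF J(1) u subset_refl pos A sm _ eps, where C = C])
        (use A Epos[OF u] g in \<open>auto intro: add_nonneg_pos\<close>)
  qed
next
  assume ode: "\<forall>u\<in>J. meridian_ode (- 1) \<alpha> \<beta> f g u = 0"
  obtain lam where lam0: "\<And>u. u \<in> J \<Longrightarrow> lam u > 0"
    and lamE: "\<And>u. u \<in> J \<Longrightarrow> (lam u)\<^sup>2 * ((deriv f u)\<^sup>2 + (- 1) * (deriv g u)\<^sup>2)
      = \<alpha>\<^sup>2 * (f u)\<^sup>2 - (- 1) * (\<beta>\<^sup>2 * (g u)\<^sup>2)"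
    and dF: "\<And>u. u \<in> J \<Longrightarrow> ((\<lambda>w. lam w * deriv f w) has_real_derivative \<alpha>\<^sup>2 * f u / lam u) (at u)"
    and dG: "\<And>u. u \<in> J \<Longrightarrow> ((\<lambda>w. lam w * deriv g w) has_real_derivative - (\<beta>\<^sup>2 * g u / lam u)) (at u)"
    by (rule meridian_ode_decoupled[OF J(1) sm, of "- 1" \<alpha> \<beta>]) (use Gpos Epos ode in auto)
  obtain A where A: "A > 0"
    and FA: "\<And>u. u \<in> J \<Longrightarrow> \<alpha>\<^sup>2 * (f u)\<^sup>2 - (- 1) * A = (lam u * deriv f u)\<^sup>2"
    and C: "\<And>\<eta>. \<eta> \<in> {-1, 1} \<Longrightarrow> \<exists>C. \<forall>u\<in>J. g u = sqrt A / \<beta> *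
      sin (\<eta> * (\<beta> / \<alpha>) * ln \<bar>\<alpha> * f u + \<eta> * (lam u * deriv f u)\<bar> + C)"
    by (rule meridian_first_integral[OF J pos sm _ lam0 lamE dF dG nz]) auto
  have "continuous_on J (\<lambda>w. lam w * deriv f w)"
    using dF by (intro continuous_at_imp_continuous_on) (auto intro: DERIV_isCont)
  moreover have "lam u * deriv f u \<noteq> 0" if "u \<in> J" for u
    using lam0[OF that] Epos[OF that] zero_le_power2[of "deriv g u"] by auto
  ultimately obtain \<eta> :: real where eta: "\<eta> \<in> {-1, 1}" "\<And>u. u \<in> J \<Longrightarrow> \<eta> * (lam u * deriv f u) > 0"
    using sign_constant_on_interval[OF J(2), of "\<lambda>u. lam u * deriv f u"] by blast
  have "sqrt (\<alpha>\<^sup>2 * (f u)\<^sup>2 + A) = \<eta> * (lam u * deriv f u)" if "u \<in> J" for u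
    using FA[OF that] eta(1) eta(2)[OF that] by (intro real_sqrt_unique) auto
  then have "meridian_formula2 \<alpha> \<beta> A f g J"
    unfolding meridian_formula2_def using C[OF eta(1)] eta(1) by (metis (no_types, lifting))
  then show "meridian_given_by_formula2 \<alpha> \<beta> f g J"
    unfolding meridian_given_by_formula2_def using A by blast
qed

theorem theorem3p5:
  fixes \<alpha> \<beta> :: real and J :: "real set" and f g :: "real \<Rightarrow> real"
  assumes "\<alpha> > 0" and "\<beta> > 0"
    and "open J" and "is_interval J" and "J \<noteq> {}"
    and "smooth_on J f" and "smooth_on J g"
  shows
    "((\<forall>u\<in>J. \<alpha>\<^sup>2 * (f u)\<^sup>2 - \<beta>\<^sup>2 * (g u)\<^sup>2 > 0) \<longrightarrow>
      (\<forall>u\<in>J. (deriv f u)\<^sup>2 + (deriv g u)\<^sup>2 > 0) \<longrightarrow>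
      \<not> contained_in_2plane J (rot_surface1 \<alpha> \<beta> f g) \<longrightarrow>
      (minimal_surface J (rot_surface1 \<alpha> \<beta> f g) \<longleftrightarrow> meridian_given_by_formula1 \<alpha> \<beta> f g J))
     \<and>
     ((\<forall>u\<in>J. (deriv f u)\<^sup>2 - (deriv g u)\<^sup>2 > 0) \<longrightarrow>
      (\<forall>u\<in>J. \<alpha>\<^sup>2 * (f u)\<^sup>2 + \<beta>\<^sup>2 * (g u)\<^sup>2 > 0) \<longrightarrow>
      \<not> contained_in_2plane J (rot_surface2 \<alpha> \<beta> f g) \<longrightarrow>
      (minimal_surface J (rot_surface2 \<alpha> \<beta> f g) \<longleftrightarrow> meridian_given_by_formula2 \<alpha> \<beta> f g J))"
proof (intro conjI impI)
  assume G: "\<forall>u\<in>J. \<alpha>\<^sup>2 * (f u)\<^sup>2 - \<beta>\<^sup>2 * (g u)\<^sup>2 > 0"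
    and E: "\<forall>u\<in>J. (deriv f u)\<^sup>2 + (deriv g u)\<^sup>2 > 0"
    and plane: "\<not> contained_in_2plane J (rot_surface1 \<alpha> \<beta> f g)"
  have nz: "\<exists>u\<in>J. g u \<noteq> 0"
    using plane contained_in_2plane_if_coordinates_vanish[of J "rot_surface1 \<alpha> \<beta> f g"]
    by (force simp: rot_surface1_def)
  have "minimal_surface J (rot_surface1 \<alpha> \<beta> f g) \<longleftrightarrow> (\<forall>u\<in>J. meridian_ode 1 \<alpha> \<beta> f g u = 0)"
    by (rule rotational_frame.minimal_surface_iff_ode[OF rotational_frame_type1 rot_surface1_eq assms(3,6,7)])
      (use G E in auto)
  also have "\<dots> \<longleftrightarrow> meridian_given_by_formula1 \<alpha> \<beta> f g J"
    using meridian_ode_imp_formula1[OF assms(3-5,1,2,6,7)]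
      meridian_given_by_formula1_imp_ode[OF assms(3,1,2,6,7)] G E nz by blast
  finally show "minimal_surface J (rot_surface1 \<alpha> \<beta> f g) \<longleftrightarrow> meridian_given_by_formula1 \<alpha> \<beta> f g J" .
next
  assume E: "\<forall>u\<in>J. (deriv f u)\<^sup>2 - (deriv g u)\<^sup>2 > 0"
    and G: "\<forall>u\<in>J. \<alpha>\<^sup>2 * (f u)\<^sup>2 + \<beta>\<^sup>2 * (g u)\<^sup>2 > 0"
    and plane: "\<not> contained_in_2plane J (rot_surface2 \<alpha> \<beta> f g)"
  have nz: "\<exists>u\<in>J. g u \<noteq> 0"
    using plane contained_in_2plane_if_coordinates_vanish[of J "rot_surface2 \<alpha> \<beta> f g"]
    by (force simp: rot_surface2_def)
  have "minimal_surface J (rot_surface2 \<alpha> \<beta> f g) \<longleftrightarrow> (\<forall>u\<in>J. meridian_ode (- 1) \<alpha> \<beta> f g u = 0)"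
    by (rule rotational_frame.minimal_surface_iff_ode[OF rotational_frame_type2 rot_surface2_eq assms(3,6,7)])
      (use G E in auto)
  also have "\<dots> \<longleftrightarrow> meridian_given_by_formula2 \<alpha> \<beta> f g J"
    using meridian_given_by_formula2_iff_ode[OF assms(3-5,1,2,6,7)] G E nz by blast
  finally show "minimal_surface J (rot_surface2 \<alpha> \<beta> f g) \<longleftrightarrow> meridian_given_by_formula2 \<alpha> \<beta> f g J" .
qed

end
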